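(* Let $\phi=F\wedge\forall x.\,Q$ be a formula in the fragment described in the context. If $\phi$ is satisfiable and $Q$ satisfies the ReqPivot condition, then the Interval-Based Satisfiability Check algorithm (described in the context) terminates on input $\phi$ and returns Sat.
   Context: Fragment. Linear integer arithmetic with uninterpreted function symbols (UFLIA). $\phi=F\wedge\forall x.\,Q$ where $F,Q$ are quantifier-free, $x$ is a single integer variable, every uninterpreted function symbol has arity $0$ (uninterpreted constants) or $1$ with integer argument and value, arguments of unary uninterpreted function symbols are linear integer terms containing no unary uninterpreted function symbols, and for each unary $f$ occurring in $Q$ all argument terms of $f$ in $Q$ have the same coefficient of $x$, whose sign is denoted $\sigma_f\in\{+,-\}$ (the coefficient is assumed nonzero). $\hat z$ is the numeral for $z\in\mathbb{Z}$, $s[x\mapsto t]$ is substitution, $args(F,f)$ is the set of argument terms of $f$ in $F$. Signs multiply as usual; $z\lessdot_+ z'$ means $z<z'$, $z\lessdot_- z'$ means $z>z'$. For $B=[b_{\min},b_{\max}]$, $B^-=b_{\min}$, $B^+=b_{\max}$. Let $\mathcal F$ be the set of unary uninterpreted function symbols in $Q$ and $\mathcal T$ the set of terms $f(t)$ in $Q$ with $f\in\mathcal F$. For $\mathcal S\subseteq\mathcal T$ and $s\in\{+,-\}$: - $\Phi^s_{\rm ext}(\mathcal S)$: the formula $\bigwedge_{f\in\mathcal F}\bigl(\bigwedge_{f(t),f(t')\in\mathcal S} t=t' \wedge \bigwedge_{f(t)\in\mathcal S,\ f(t')\in\mathcal T\setminus\mathcal S} t'\lessdot_{\sigma_f s}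 t\bigr)$ with $x$ replaced by $\hat 0$ (terms with the same head symbol $f$). - $\Phi_{\rm prop}(\mathcal S)$: $\forall x\,\forall\bar u\,\exists\bar v.\ Q'(\mathcal S)$, with fresh integer variables $\bar u=(u_{f(t)})_{f(t)\in\mathcal T\setminus\mathcal S}$, $\bar v=(v_{f(t)})_{f(t)\in\mathcal S}$, and $Q'(\mathcal S)$ obtained from $Q$ by simultaneously replacing each $f(t)\in\mathcal T\setminus\mathcal S$ by $u_{f(t)}$ and each $f(t)\in\mathcal S$ by $v_{f(t)}$. - $Q$ satisfies the ReqPivot condition iff there exist $\mathcal S,\mathcal S'\subseteq\mathcal T$ such that $\Phi^+_{\rm ext}(\mathcal S)$, $\Phi_{\rm prop}(\mathcal S)$, $\Phi^-_{\rm ext}(\mathcal S')$ and $\Phi_{\rm prop}(\mathcal S')$ are satisfiable. - $\Psi^s(B,\mathcal S):=\Phi^s_{\rm ext}(\mathcal S)\wedge\Phi_{\rm prop}(\mathcal S)\wedge\bigwedge_{f(t)\in\mathcal S}\bigwedge_{a\in args(F,f)} a\lessdot_{\sigma_f s} t[x\mapsto \widehat{B^s}]$. Algorithm (Interval-Based Satisfiability Check). Set $b_{\min}:=0$, $b_{\max}:=0$. While $F\wedge\bigwedge_{z=b_{\min}}^{b_{\max}}Q[x\mapsto\hat z]$ is satisfiable: if $\bigl(F\wedge\bigwedge_{z=b_{\min}}^{b_{\max}}Q[x\mapsto\hat z]\bigr)\wedge\bigvee_{\mathcal S\subseteq\mathcal T}\Psi^+([b_{\min},b_{\max}],\mathcal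 S)\wedge\bigvee_{\mathcal S'\subseteq\mathcal T}\Psi^-([b_{\min},b_{\max}],\mathcal S')$ is satisfiable, return Sat; otherwise set $b_{\min}:=b_{\min}-1$, $b_{\max}:=b_{\max}+1$ and continue. If the loop exits, return Unsat. (Satisfiability checks are exact decisions in UFLIA/Presburger arithmetic.)
   Formalization: The satisfiability of φ and of the four ReqPivot formulas is required under one common interpretation of the uninterpreted constants; with unrelated interpretations the claim fails, e.g. F: c=0, Q: c=1 ∨ f(x)=2f(x+1). *)

theory Defs
  imports "HOL-Library.While_Combinator"
begin

section \<open>Linear integer arithmetic with uninterpreted functions\<close>

text \<open>
  \<^typ>\<open>'f\<close> holds the unary uninterpreted function symbols, \<^typ>\<open>'c\<close> the uninterpreted constants.
  The integer variables are the distinguished variable \<open>X\<close> of the matrix and, for every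
  application \<open>f(t)\<close>, two variables \<open>U f t\<close> and \<open>V f t\<close>. The latter are fresh for all
  input formulas, since these contain no variable besides \<open>X\<close>.
\<close>

datatype (plugins only: size) ('f, 'c) tm =
    Num int
  | Const 'c
  | Var "('f, 'c) var"
  | App 'f "('f, 'c) tm"
  | Add "('f, 'c) tm" "('f, 'c) tm"
  | Scale int "('f, 'c) tm"
and ('f, 'c) var =
    X
  | U 'f "('f, 'c) tm"
  | V 'f "('f, 'c) tm"

datatype (plugins only: size) ('f, 'c) fm =
    Tr
  | Eq "('f, 'c) tm" "('f, 'c) tm"
  | Le "('f, 'c) tm" "('f, 'c) tm"
  | Lt "('f, 'c) tm" "('f, 'c) tm"
  | Neg "('f, 'c) fm"
  | And "('f, 'c) fm" "('f, 'c) fm"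
  | Or "('f, 'c) fm" "('f, 'c) fm"
  | Forall "('f, 'c) var" "('f, 'c) fm"
  | Exists "('f, 'c) var" "('f, 'c) fm"

definition AND :: "('f, 'c) fm list \<Rightarrow> ('f, 'c) fm" where
  "AND \<phi>s = foldr And \<phi>s Tr"

definition OR :: "('f, 'c) fm list \<Rightarrow> ('f, 'c) fm" where
  "OR \<phi>s = foldr Or \<phi>s (Neg Tr)"

subsection \<open>Semantics\<close>

primrec eval :: "('c \<Rightarrow> int) \<Rightarrow> ('f \<Rightarrow> int \<Rightarrow> int) \<Rightarrow> (('f, 'c) var \<Rightarrow> int) \<Rightarrow> ('f, 'c) tm \<Rightarrow> int" where
  "eval \<kappa> \<iota> \<rho> (Num z) = z"
| "eval \<kappa> \<iota> \<rho> (Const c) = \<kappa> c"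
| "eval \<kappa> \<iota> \<rho> (Var y) = \<rho> y"
| "eval \<kappa> \<iota> \<rho> (App f t) = \<iota> f (eval \<kappa> \<iota> \<rho> t)"
| "eval \<kappa> \<iota> \<rho> (Add s t) = eval \<kappa> \<iota> \<rho> s + eval \<kappa> \<iota> \<rho> t"
| "eval \<kappa> \<iota> \<rho> (Scale k t) = k * eval \<kappa> \<iota> \<rho> t"

primrec holds :: "('c \<Rightarrow> int) \<Rightarrow> ('f \<Rightarrow> int \<Rightarrow> int) \<Rightarrow> (('f, 'c) var \<Rightarrow> int) \<Rightarrow> ('f, 'c) fm \<Rightarrow> bool" where
  "holds \<kappa> \<iota> \<rho> Tr \<longleftrightarrow> True"
| "holds \<kappa> \<iota> \<rho> (Eq s t) \<longleftrightarrow> eval \<kappa> \<iota> \<rho> s = eval \<kappa> \<iota> \<rho> t"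
| "holds \<kappa> \<iota> \<rho> (Le s t) \<longleftrightarrow> eval \<kappa> \<iota> \<rho> s \<le> eval \<kappa> \<iota> \<rho> t"
| "holds \<kappa> \<iota> \<rho> (Lt s t) \<longleftrightarrow> eval \<kappa> \<iota> \<rho> s < eval \<kappa> \<iota> \<rho> t"
| "holds \<kappa> \<iota> \<rho> (Neg \<phi>) \<longleftrightarrow> \<not> holds \<kappa> \<iota> \<rho> \<phi>"
| "holds \<kappa> \<iota> \<rho> (And \<phi> \<psi>) \<longleftrightarrow> holds \<kappa> \<iota> \<rho> \<phi> \<and> holds \<kappa> \<iota> \<rho> \<psi>"
| "holds \<kappa> \<iota> \<rho> (Or \<phi> \<psi>) \<longleftrightarrow> holds \<kappa> \<iota> \<rho> \<phi> \<or> holds \<kappa> \<iota> \<rho> \<psi>"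
| "holds \<kappa> \<iota> \<rho> (Forall y \<phi>) \<longleftrightarrow> (\<forall>z. holds \<kappa> \<iota> (\<rho>(y := z)) \<phi>)"
| "holds \<kappa> \<iota> \<rho> (Exists y \<phi>) \<longleftrightarrow> (\<exists>z. holds \<kappa> \<iota> (\<rho>(y := z)) \<phi>)"

definition satisfiable_at :: "('c \<Rightarrow> int) \<Rightarrow> ('f, 'c) fm \<Rightarrow> bool" where
  "satisfiable_at \<kappa> \<phi> \<longleftrightarrow> (\<exists>\<iota> \<rho>. holds \<kappa> \<iota> \<rho> \<phi>)"

definition satisfiable :: "('f, 'c) fm \<Rightarrow> bool" where
  "satisfiable \<phi> \<longleftrightarrow> (\<exists>\<kappa>. satisfiable_at \<kappa> \<phi>)"

subsection \<open>Syntactic notions\<close>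

primrec tm_vars :: "('f, 'c) tm \<Rightarrow> ('f, 'c) var set" where
  "tm_vars (Var y) = {y}"
| "tm_vars (App f t) = tm_vars t"
| "tm_vars (Add s t) = tm_vars s \<union> tm_vars t"
| "tm_vars (Scale k t) = tm_vars t"
| "tm_vars (Num z) = {}"
| "tm_vars (Const c) = {}"

primrec free_vars :: "('f, 'c) fm \<Rightarrow> ('f, 'c) var set" where
  "free_vars Tr = {}"
| "free_vars (Eq s t) = tm_vars s \<union> tm_vars t"
| "free_vars (Le s t) = tm_vars s \<union> tm_vars t"
| "free_vars (Lt s t) = tm_vars s \<union> tm_vars t"
| "free_vars (Neg \<phi>) = free_vars \<phi>"
| "free_vars (And \<phi> \<psi>) = free_vars \<phi> \<union> free_vars \<psi>"
| "free_vars (Or \<phi> \<psi>) = free_vars \<phi> \<union> free_vars \<psi>"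
| "free_vars (Forall y \<phi>) = free_vars \<phi> - {y}"
| "free_vars (Exists y \<phi>) = free_vars \<phi> - {y}"

primrec quantifier_free :: "('f, 'c) fm \<Rightarrow> bool" where
  "quantifier_free (Neg \<phi>) \<longleftrightarrow> quantifier_free \<phi>"
| "quantifier_free (And \<phi> \<psi>) \<longleftrightarrow> quantifier_free \<phi> \<and> quantifier_free \<psi>"
| "quantifier_free (Or \<phi> \<psi>) \<longleftrightarrow> quantifier_free \<phi> \<and> quantifier_free \<psi>"
| "quantifier_free (Forall y \<phi>) \<longleftrightarrow> False"
| "quantifier_free (Exists y \<phi>) \<longleftrightarrow> False"
| "quantifier_free Tr \<longleftrightarrow> True"
| "quantifier_free (Eq s t) \<longleftrightarrow> True"
| "quantifier_free (Le s t) \<longleftrightarrow> True"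
| "quantifier_free (Lt s t) \<longleftrightarrow> True"

text \<open>An application \<open>f(t)\<close> is represented by the pair \<open>(f, t)\<close>.\<close>

primrec tm_apps :: "('f, 'c) tm \<Rightarrow> ('f \<times> ('f, 'c) tm) list" where
  "tm_apps (App f t) = (f, t) # tm_apps t"
| "tm_apps (Add s t) = tm_apps s @ tm_apps t"
| "tm_apps (Scale k t) = tm_apps t"
| "tm_apps (Num z) = []"
| "tm_apps (Const c) = []"
| "tm_apps (Var y) = []"

primrec fm_apps :: "('f, 'c) fm \<Rightarrow> ('f \<times> ('f, 'c) tm) list" where
  "fm_apps Tr = []"
| "fm_apps (Eq s t) = tm_apps s @ tm_apps t"
| "fm_apps (Le s t) = tm_apps s @ tm_apps t"
| "fm_apps (Lt s t) = tm_apps s @ tm_apps t"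
| "fm_apps (Neg \<phi>) = fm_apps \<phi>"
| "fm_apps (And \<phi> \<psi>) = fm_apps \<phi> @ fm_apps \<psi>"
| "fm_apps (Or \<phi> \<psi>) = fm_apps \<phi> @ fm_apps \<psi>"
| "fm_apps (Forall y \<phi>) = fm_apps \<phi>"
| "fm_apps (Exists y \<phi>) = fm_apps \<phi>"

definition apps :: "('f, 'c) fm \<Rightarrow> ('f \<times> ('f, 'c) tm) list" where
  "apps \<phi> = remdups (fm_apps \<phi>)"

definition args :: "('f, 'c) fm \<Rightarrow> 'f \<Rightarrow> ('f, 'c) tm list" where
  "args \<phi> f = [t. (g, t) \<leftarrow> apps \<phi>, g = f]"

text \<open>Coefficient of \<open>X\<close>, for terms without function applications.\<close>

primrec x_coeff :: "('f, 'c) tm \<Rightarrow> int" where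
  "x_coeff (Var y) = (if y = X then 1 else 0)"
| "x_coeff (Add s t) = x_coeff s + x_coeff t"
| "x_coeff (Scale k t) = k * x_coeff t"
| "x_coeff (App f t) = 0"
| "x_coeff (Num z) = 0"
| "x_coeff (Const c) = 0"

definition in_fragment :: "('f, 'c) fm \<Rightarrow> ('f, 'c) fm \<Rightarrow> bool" where
  "in_fragment F Q \<longleftrightarrow>
     quantifier_free F \<and> free_vars F = {} \<and>
     quantifier_free Q \<and> free_vars Q \<subseteq> {X} \<and>
     (\<forall>(f, t) \<in> set (apps F) \<union> set (apps Q). tm_apps t = []) \<and>
     (\<forall>(f, t) \<in> set (apps Q). x_coeff t \<noteq> 0) \<and>
     (\<forall>f t t'. (f, t) \<in> set (apps Q) \<longrightarrow> (f, t') \<in> set (apps Q) \<longrightarrow> x_coeff t = x_coeff t')"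

text \<open>Signs are the integers \<open>1\<close> and \<open>-1\<close>.\<close>

definition arg_sign :: "('f, 'c) fm \<Rightarrow> 'f \<Rightarrow> int" where
  "arg_sign Q f = sgn (x_coeff (SOME t. (f, t) \<in> set (apps Q)))"

definition less_sign :: "int \<Rightarrow> ('f, 'c) tm \<Rightarrow> ('f, 'c) tm \<Rightarrow> ('f, 'c) fm" where
  "less_sign s t t' = (if s > 0 then Lt t t' else Lt t' t)"

definition endpoint :: "int \<Rightarrow> int \<times> int \<Rightarrow> int" where
  "endpoint s B = (if s > 0 then snd B else fst B)"

text \<open>Substitution of a numeral for \<open>X\<close>.\<close>

primrec inst_tm :: "int \<Rightarrow> ('f, 'c) tm \<Rightarrow> ('f, 'c) tm" where
  "inst_tm z (Var y) = (if y = X then Num z else Var y)"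
| "inst_tm z (App f t) = App f (inst_tm z t)"
| "inst_tm z (Add s t) = Add (inst_tm z s) (inst_tm z t)"
| "inst_tm z (Scale k t) = Scale k (inst_tm z t)"
| "inst_tm z (Num m) = Num m"
| "inst_tm z (Const c) = Const c"

primrec inst :: "int \<Rightarrow> ('f, 'c) fm \<Rightarrow> ('f, 'c) fm" where
  "inst z Tr = Tr"
| "inst z (Eq s t) = Eq (inst_tm z s) (inst_tm z t)"
| "inst z (Le s t) = Le (inst_tm z s) (inst_tm z t)"
| "inst z (Lt s t) = Lt (inst_tm z s) (inst_tm z t)"
| "inst z (Neg \<phi>) = Neg (inst z \<phi>)"
| "inst z (And \<phi> \<psi>) = And (inst z \<phi>) (inst z \<psi>)"
| "inst z (Or \<phi> \<psi>) = Or (inst z \<phi>) (inst z \<psi>)"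
| "inst z (Forall y \<phi>) = Forall y (if y = X then \<phi> else inst z \<phi>)"
| "inst z (Exists y \<phi>) = Exists y (if y = X then \<phi> else inst z \<phi>)"

text \<open>Replacement of the applications in \<open>S\<close> by \<open>V\<close>-variables and of all others by \<open>U\<close>-variables.\<close>

primrec abstract_tm :: "('f \<times> ('f, 'c) tm) set \<Rightarrow> ('f, 'c) tm \<Rightarrow> ('f, 'c) tm" where
  "abstract_tm S (App f t) = Var (if (f, t) \<in> S then V f t else U f t)"
| "abstract_tm S (Add s t) = Add (abstract_tm S s) (abstract_tm S t)"
| "abstract_tm S (Scale k t) = Scale k (abstract_tm S t)"
| "abstract_tm S (Var y) = Var y"
| "abstract_tm S (Num z) = Num z"
| "abstract_tm S (Const c) = Const c"

primrec abstract :: "('f \<times> ('f, 'c) tm) set \<Rightarrow> ('f, 'c) fm \<Rightarrow> ('f, 'c) fm" where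
  "abstract S Tr = Tr"
| "abstract S (Eq s t) = Eq (abstract_tm S s) (abstract_tm S t)"
| "abstract S (Le s t) = Le (abstract_tm S s) (abstract_tm S t)"
| "abstract S (Lt s t) = Lt (abstract_tm S s) (abstract_tm S t)"
| "abstract S (Neg \<phi>) = Neg (abstract S \<phi>)"
| "abstract S (And \<phi> \<psi>) = And (abstract S \<phi>) (abstract S \<psi>)"
| "abstract S (Or \<phi> \<psi>) = Or (abstract S \<phi>) (abstract S \<psi>)"
| "abstract S (Forall y \<phi>) = Forall y (abstract S \<phi>)"
| "abstract S (Exists y \<phi>) = Exists y (abstract S \<phi>)"

section \<open>Requantification pivots\<close>

definition ext_fm :: "int \<Rightarrow> ('f, 'c) fm \<Rightarrow> ('f \<times> ('f, 'c) tm) set \<Rightarrow> ('f, 'c) fm" where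
  "ext_fm s Q S = inst 0 (And
     (AND [Eq t t'. (f, t) \<leftarrow> apps Q, (g, t') \<leftarrow> apps Q,
        f = g \<and> (f, t) \<in> S \<and> (g, t') \<in> S])
     (AND [less_sign (arg_sign Q f * s) t' t. (f, t) \<leftarrow> apps Q, (g, t') \<leftarrow> apps Q,
        f = g \<and> (f, t) \<in> S \<and> (g, t') \<notin> S]))"

definition prop_fm :: "('f, 'c) fm \<Rightarrow> ('f \<times> ('f, 'c) tm) set \<Rightarrow> ('f, 'c) fm" where
  "prop_fm Q S = Forall X
     (foldr (\<lambda>(f, t). Forall (U f t)) (filter (\<lambda>a. a \<notin> S) (apps Q))
       (foldr (\<lambda>(f, t). Exists (V f t)) (filter (\<lambda>a. a \<in> S) (apps Q))
         (abstract S Q)))"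

text \<open>
  The formulas of the condition may contain uninterpreted constants of \<open>Q\<close>. In
  \<open>req_pivot_at \<kappa> Q\<close> these are interpreted by \<open>\<kappa>\<close> in all four formulas; in
  \<open>req_pivot Q\<close> each formula may be satisfied by an interpretation of its own.
\<close>

definition req_pivot_at :: "('c \<Rightarrow> int) \<Rightarrow> ('f, 'c) fm \<Rightarrow> bool" where
  "req_pivot_at \<kappa> Q \<longleftrightarrow> (\<exists>S S'. S \<subseteq> set (apps Q) \<and> S' \<subseteq> set (apps Q) \<and>
     satisfiable_at \<kappa> (ext_fm 1 Q S) \<and> satisfiable_at \<kappa> (prop_fm Q S) \<and>
     satisfiable_at \<kappa> (ext_fm (-1) Q S') \<and> satisfiable_at \<kappa> (prop_fm Q S'))"

definition req_pivot :: "('f, 'c) fm \<Rightarrow> bool" where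
  "req_pivot Q \<longleftrightarrow> (\<exists>S S'. S \<subseteq> set (apps Q) \<and> S' \<subseteq> set (apps Q) \<and>
     satisfiable (ext_fm 1 Q S) \<and> satisfiable (prop_fm Q S) \<and>
     satisfiable (ext_fm (-1) Q S') \<and> satisfiable (prop_fm Q S'))"

section \<open>Interval-based satisfiability check\<close>

definition psi_fm ::
  "int \<Rightarrow> ('f, 'c) fm \<Rightarrow> ('f, 'c) fm \<Rightarrow> int \<times> int \<Rightarrow> ('f \<times> ('f, 'c) tm) set \<Rightarrow> ('f, 'c) fm" where
  "psi_fm s F Q B S = And (And (ext_fm s Q S) (prop_fm Q S))
     (AND [less_sign (arg_sign Q f * s) a (inst_tm (endpoint s B) t).
        (f, t) \<leftarrow> apps Q, (f, t) \<in> S, a \<leftarrow> args F f])"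

definition ground_fm :: "('f, 'c) fm \<Rightarrow> ('f, 'c) fm \<Rightarrow> int \<times> int \<Rightarrow> ('f, 'c) fm" where
  "ground_fm F Q B = And F (AND [inst z Q. z \<leftarrow> [fst B..snd B]])"

definition check_fm :: "('f, 'c) fm \<Rightarrow> ('f, 'c) fm \<Rightarrow> int \<times> int \<Rightarrow> ('f, 'c) fm" where
  "check_fm F Q B = And (ground_fm F Q B)
     (And (OR [psi_fm 1 F Q B S. S \<leftarrow> map set (subseqs (apps Q))])
          (OR [psi_fm (-1) F Q B S'. S' \<leftarrow> map set (subseqs (apps Q))]))"

datatype verdict = Sat | Unsat

datatype state = Running "int \<times> int" | Returned verdict

primrec is_running :: "state \<Rightarrow> bool" where
  "is_running (Running B) \<longleftrightarrow> True"
| "is_running (Returned r) \<longleftrightarrow> False"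

primrec step :: "('f, 'c) fm \<Rightarrow> ('f, 'c) fm \<Rightarrow> state \<Rightarrow> state" where
  "step F Q (Running B) =
     (if satisfiable (ground_fm F Q B)
      then if satisfiable (check_fm F Q B)
           then Returned Sat
           else Running (fst B - 1, snd B + 1)
      else Returned Unsat)"
| "step F Q (Returned r) = Returned r"

text \<open>The result is \<^const>\<open>None\<close> iff the loop does not terminate.\<close>

definition interval_check :: "('f, 'c) fm \<Rightarrow> ('f, 'c) fm \<Rightarrow> state option" where
  "interval_check F Q = while_option is_running (step F Q) (Running (0, 0))"

section \<open>The role of uninterpreted constants in the pivot condition\<close>

text \<open>If \<open>Q\<close> contains no uninterpreted constants, the two versions of the condition coincide.\<close>

primrec tm_csts :: "('f, 'c) tm \<Rightarrow> 'c set" where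
  "tm_csts (Const c) = {c}"
| "tm_csts (App f t) = tm_csts t"
| "tm_csts (Add s t) = tm_csts s \<union> tm_csts t"
| "tm_csts (Scale k t) = tm_csts t"
| "tm_csts (Num z) = {}"
| "tm_csts (Var y) = {}"

primrec csts :: "('f, 'c) fm \<Rightarrow> 'c set" where
  "csts Tr = {}"
| "csts (Eq s t) = tm_csts s \<union> tm_csts t"
| "csts (Le s t) = tm_csts s \<union> tm_csts t"
| "csts (Lt s t) = tm_csts s \<union> tm_csts t"
| "csts (Neg \<phi>) = csts \<phi>"
| "csts (And \<phi> \<psi>) = csts \<phi> \<union> csts \<psi>"
| "csts (Or \<phi> \<psi>) = csts \<phi> \<union> csts \<psi>"
| "csts (Forall y \<phi>) = csts \<phi>"
| "csts (Exists y \<phi>) = csts \<phi>"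

lemma tm_induct [case_names Num Const Var App Add Scale]:
  assumes "\<And>z. P (Num z)" "\<And>c. P (Const c)" "\<And>y. P (Var y)"
    and "\<And>f t. P t \<Longrightarrow> P (App f t)"
    and "\<And>s t. P s \<Longrightarrow> P t \<Longrightarrow> P (Add s t)"
    and "\<And>k t. P t \<Longrightarrow> P (Scale k t)"
  shows "P t"
proof -
  have "P t \<and> (\<lambda>_. True) (X :: ('a, 'b) var)"
    by (rule tm_var.induct) (simp_all add: assms)
  then show ?thesis ..
qed

lemma eval_csts_cong:
  "(\<And>c. c \<in> tm_csts t \<Longrightarrow> \<kappa> c = \<kappa>' c) \<Longrightarrow> eval \<kappa> \<iota> \<rho> t = eval \<kappa>' \<iota> \<rho> t"
  by (induct t rule: tm_induct) auto

lemma holds_csts_cong: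
  "(\<And>c. c \<in> csts \<phi> \<Longrightarrow> \<kappa> c = \<kappa>' c) \<Longrightarrow> holds \<kappa> \<iota> \<rho> \<phi> = holds \<kappa>' \<iota> \<rho> \<phi>"
proof (induction \<phi> arbitrary: \<rho>)
  case (Eq s t)
  then show ?case using eval_csts_cong[of s \<kappa> \<kappa>'] eval_csts_cong[of t \<kappa> \<kappa>'] by simp
next
  case (Le s t)
  then show ?case using eval_csts_cong[of s \<kappa> \<kappa>'] eval_csts_cong[of t \<kappa> \<kappa>'] by simp
next
  case (Lt s t)
  then show ?case using eval_csts_cong[of s \<kappa> \<kappa>'] eval_csts_cong[of t \<kappa> \<kappa>'] by simp
qed auto

lemma satisfiable_at_csts_empty:
  assumes "csts \<phi> = {}"
  shows "satisfiable_at \<kappa> \<phi> \<longleftrightarrow> satisfiable \<phi>"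
  unfolding satisfiable_def satisfiable_at_def
  using holds_csts_cong[of \<phi>] assms by blast

lemma tm_csts_apps: "(f, t) \<in> set (tm_apps s) \<Longrightarrow> tm_csts t \<subseteq> tm_csts s"
  by (induct s rule: tm_induct) auto

lemma csts_apps: "(f, t) \<in> set (apps \<phi>) \<Longrightarrow> tm_csts t \<subseteq> csts \<phi>"
  unfolding apps_def by (induction \<phi>) (auto dest!: tm_csts_apps)

lemma tm_csts_inst: "tm_csts (inst_tm z t) = tm_csts t"
  by (induct t rule: tm_induct) auto

lemma csts_inst: "csts (inst z \<phi>) = csts \<phi>"
  by (induction \<phi>) (auto simp: tm_csts_inst)

lemma tm_csts_abstract: "tm_csts (abstract_tm S t) \<subseteq> tm_csts t"
  by (induct t rule: tm_induct) auto

lemma csts_abstract: "csts (abstract S \<phi>) \<subseteq> csts \<phi>"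
  by (induction \<phi>) (auto dest!: subsetD[OF tm_csts_abstract])

lemma csts_AND: "csts (AND \<phi>s) = (\<Union>\<phi> \<in> set \<phi>s. csts \<phi>)"
  unfolding AND_def by (induction \<phi>s) auto

lemma csts_less_sign: "csts (less_sign s t t') = tm_csts t \<union> tm_csts t'"
  by (auto simp: less_sign_def)

lemma csts_ext_fm: "csts (ext_fm s Q S) \<subseteq> csts Q"
  unfolding ext_fm_def csts_inst csts.simps csts_AND
proof (intro Un_least UN_least, goal_cases)
  case (1 \<phi>)
  then obtain f t f' t' where "(f, t) \<in> set (apps Q)" "(f', t') \<in> set (apps Q)" "\<phi> = Eq t t'"
    by (clarsimp split: if_splits)
  then show ?case
    using csts_apps[of f t Q] csts_apps[of f' t' Q] by simp
next
  case (2 \<phi>)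
  then obtain f t f' t' r where "(f, t) \<in> set (apps Q)" "(f', t') \<in> set (apps Q)"
    "\<phi> = less_sign r t' t"
    by (clarsimp split: if_splits)
  then show ?case
    using csts_apps[of f t Q] csts_apps[of f' t' Q] by (simp add: csts_less_sign)
qed

lemma csts_foldr_Forall: "csts (foldr (\<lambda>(f, t). Forall (U f t)) as \<phi>) = csts \<phi>"
  by (induct as) (simp_all split: prod.split)

lemma csts_foldr_Exists: "csts (foldr (\<lambda>(f, t). Exists (V f t)) as \<phi>) = csts \<phi>"
  by (induct as) (simp_all split: prod.split)

lemma csts_prop_fm: "csts (prop_fm Q S) \<subseteq> csts Q"
  unfolding prop_fm_def csts.simps csts_foldr_Forall csts_foldr_Exists by (rule csts_abstract)

lemma req_pivot_at_iff_req_pivot: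
  assumes "csts Q = {}"
  shows "req_pivot_at \<kappa> Q \<longleftrightarrow> req_pivot Q"
proof -
  have "csts (ext_fm s Q S) = {}" "csts (prop_fm Q S) = {}" for s S
    using csts_ext_fm[of s Q S] csts_prop_fm[of Q S] assms by auto
  then show ?thesis
    unfolding req_pivot_def req_pivot_at_def by (simp add: satisfiable_at_csts_empty)
qed

text \<open>
  With uninterpreted constants in \<open>Q\<close>, satisfiability of the input together with the pivot
  condition for unrelated interpretations of the constants does not ensure termination. A
  counterexample is \<open>c = 0 \<and> (\<forall>x. c = 1 \<or> f(x) = 2 * f(x + 1))\<close>, even when the four formulas
  of the pivot condition are satisfied by one common interpretation.
\<close>

lemma unrelated_constants_counterexample:
  "\<exists>(F :: (unit, unit) fm) Q. in_fragment F Q \<and> satisfiable (And F (Forall X Q)) \<and>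
     req_pivot Q \<and> (\<exists>\<kappa>. req_pivot_at \<kappa> Q) \<and> interval_check F Q \<noteq> Some (Returned Sat)"
proof -
  define F :: "(unit, unit) fm" where "F = Eq (Const ()) (Num 0)"
  define t0 :: "(unit, unit) tm" where "t0 = Var X"
  define t1 :: "(unit, unit) tm" where "t1 = Add (Var X) (Num 1)"
  define Q :: "(unit, unit) fm" where
    "Q = Or (Eq (Const ()) (Num 1)) (Eq (App () t0) (Scale 2 (App () t1)))"
  have ap: "apps Q = [((), t0), ((), t1)]" "apps F = []"
    by (simp_all add: apps_def Q_def F_def t0_def t1_def)
  have ab: "abstract S Q = Or (Eq (Const ()) (Num 1))
      (Eq (abstract_tm S (App () t0)) (Scale 2 (abstract_tm S (App () t1))))" for S
    by (simp add: Q_def)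
  have tt: "t0 \<noteq> t1" "t1 \<noteq> t0"
    by (simp_all add: t0_def t1_def)
  have iv: "eval \<kappa> \<iota> \<rho> (inst_tm z t0) = z" "eval \<kappa> \<iota> \<rho> (inst_tm z t1) = z + 1" for \<kappa> \<iota> \<rho> z
    by (simp_all add: t0_def t1_def)
  have frag: "in_fragment F Q"
    unfolding in_fragment_def ap by (auto simp: Q_def F_def t0_def t1_def)
  have sat: "satisfiable (And F (Forall X Q))"
    unfolding satisfiable_def satisfiable_at_def
    by (rule exI[of _ "\<lambda>_. 0"], rule exI[of _ "\<lambda>_ _. 0"]) (simp add: F_def Q_def)
  have at: "req_pivot_at (\<lambda>_. 1) Q"
    unfolding req_pivot_at_def satisfiable_at_def
    by (rule exI[of _ "{}"], rule exI[of _ "{}"])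
      (simp add: ext_fm_def prop_fm_def ap ab AND_def)
  then have piv: "req_pivot Q"
    unfolding req_pivot_def req_pivot_at_def satisfiable_def by blast
  have sg: "arg_sign Q () = 1"
  proof -
    have "(SOME t. ((), t) \<in> set (apps Q)) \<in> {t0, t1}"
      unfolding ap by (rule someI2[of _ t0]) auto
    then show ?thesis unfolding arg_sign_def by (auto simp: t0_def t1_def)
  qed
  have no: "\<not> holds \<kappa> \<iota> \<rho> (psi_fm 1 F Q B S)"
    if k: "\<kappa> () = 0" and S: "S \<in> set (map set (subseqs (apps Q)))" for \<kappa> \<iota> \<rho> B S
  proof
    assume h: "holds \<kappa> \<iota> \<rho> (psi_fm 1 F Q B S)"
    from S have "S = {} \<or> S = {((), t0)} \<or> S = {((), t1)} \<or> S = {((), t0), ((), t1)}"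
      unfolding ap by (auto simp: Let_def)
    moreover from h have e: "holds \<kappa> \<iota> \<rho> (ext_fm 1 Q S)" and p: "holds \<kappa> \<iota> \<rho> (prop_fm Q S)"
      by (simp_all add: psi_fm_def)
    have "S \<noteq> {}"
    proof
      assume "S = {}"
      with p have "\<forall>a b. a = 2 * (b :: int)"
        by (simp add: prop_fm_def ap ab k tt)
      then have "(1 :: int) = 2 * 1" by blast
      then show False by simp
    qed
    moreover have "S \<noteq> {((), t0)}"
      using e by (auto simp: ext_fm_def ap AND_def less_sign_def sg tt iv)
    moreover have "S \<noteq> {((), t1)}"
    proof
      assume "S = {((), t1)}"
      with p have "\<forall>a. \<exists>b. a = 2 * (b :: int)"
        by (simp add: prop_fm_def ap ab k tt)
      then obtain b :: int where "1 = 2 * b" by blast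
      then show False by presburger
    qed
    moreover have "S \<noteq> {((), t0), ((), t1)}"
      using e by (auto simp: ext_fm_def ap AND_def tt iv)
    ultimately show False by blast
  qed
  have holds_OR: "holds \<kappa> \<iota> \<rho> (OR \<phi>s) \<longleftrightarrow> (\<exists>\<phi> \<in> set \<phi>s. holds \<kappa> \<iota> \<rho> \<phi>)"
    for \<kappa> \<iota> \<rho> and \<phi>s :: "(unit, unit) fm list"
    unfolding OR_def by (induction \<phi>s) auto
  have unsat: "\<not> satisfiable (check_fm F Q B)" for B
  proof
    assume "satisfiable (check_fm F Q B)"
    then obtain \<kappa> \<iota> \<rho> where "holds \<kappa> \<iota> \<rho> (check_fm F Q B)"
      by (auto simp: satisfiable_def satisfiable_at_def)
    then have "\<kappa> () = 0"
      and "\<exists>S \<in> set (map set (subseqs (apps Q))). holds \<kappa> \<iota> \<rho> (psi_fm 1 F Q B S)"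
      by (auto simp: check_fm_def ground_fm_def F_def holds_OR)
    with no show False by blast
  qed
  have "interval_check F Q \<noteq> Some (Returned Sat)"
  proof
    assume "interval_check F Q = Some (Returned Sat)"
    then have "while_option is_running (step F Q) (Running (0, 0)) = Some (Returned Sat)"
      by (simp add: interval_check_def)
    moreover have "step F Q st \<noteq> Returned Sat" if "st \<noteq> Returned Sat" for st
      using that unsat by (cases st) auto
    ultimately have "Returned Sat \<noteq> Returned Sat"
      using while_option_rule[where P = "\<lambda>st. st \<noteq> Returned Sat"] by blast
    then show False by simp
  qed
  with frag sat at piv show ?thesis by blast
qed

end

theory Submission
  imports Defs
begin

text \<open>
  Under the constants \<open>\<kappa>\<close>, the formulas \<open>ext_fm\<close> and \<open>prop_fm\<close> are closed and contain no
  function application, so their truth depends on \<open>\<kappa>\<close> alone and the model of the input satisfies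
  the ones provided by the pivot condition. The remaining conjuncts of \<open>psi_fm\<close> compare the fixed
  value of an argument in \<open>F\<close> with a term whose value is linear in the endpoint, with nonzero slope
  of the right sign; they hold in this same model once the interval is large enough.
\<close>

section \<open>Semantics of closed and instantiated formulas\<close>

lemma holds_AND [simp]: "holds \<kappa> \<iota> \<rho> (AND \<phi>s) \<longleftrightarrow> (\<forall>\<phi> \<in> set \<phi>s. holds \<kappa> \<iota> \<rho> \<phi>)"
  unfolding AND_def by (induction \<phi>s) auto

lemma holds_OR [simp]: "holds \<kappa> \<iota> \<rho> (OR \<phi>s) \<longleftrightarrow> (\<exists>\<phi> \<in> set \<phi>s. holds \<kappa> \<iota> \<rho> \<phi>)"
  unfolding OR_def by (induction \<phi>s) auto

lemma eval_inst_tm: "eval \<kappa> \<iota> \<rho> (inst_tm z t) = eval \<kappa> \<iota> (\<rho>(X := z)) t"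
  by (induct t rule: tm_induct) auto

text \<open>Under a quantifier binding \<open>X\<close> the later update overrides the outer one,
  which matches \<open>inst\<close> leaving that body unchanged.\<close>

lemma holds_inst: "holds \<kappa> \<iota> \<rho> (inst z \<phi>) \<longleftrightarrow> holds \<kappa> \<iota> (\<rho>(X := z)) \<phi>"
  by (induction \<phi> arbitrary: \<rho>) (auto simp: eval_inst_tm fun_upd_twist)

lemma eval_cong:
  "tm_apps t = [] \<Longrightarrow> (\<And>y. y \<in> tm_vars t \<Longrightarrow> \<rho> y = \<rho>' y) \<Longrightarrow> eval \<kappa> \<iota> \<rho> t = eval \<kappa> \<iota>' \<rho>' t"
  by (induct t rule: tm_induct) auto

text \<open>\<open>\<iota>\<close> and \<open>\<iota>'\<close> are unrelated: without applications,
  function symbols never reach the evaluation. This lets a pivot formula satisfied in one model be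
  carried over to another with the same constants.\<close>

lemma holds_cong:
  "fm_apps \<phi> = [] \<Longrightarrow> (\<And>y. y \<in> free_vars \<phi> \<Longrightarrow> \<rho> y = \<rho>' y) \<Longrightarrow>
    holds \<kappa> \<iota> \<rho> \<phi> \<longleftrightarrow> holds \<kappa> \<iota>' \<rho>' \<phi>"
proof (induction \<phi> arbitrary: \<rho> \<rho>')
  case (Eq s t)
  then show ?case using eval_cong[of s \<rho> \<rho>' \<kappa> \<iota> \<iota>'] eval_cong[of t \<rho> \<rho>' \<kappa> \<iota> \<iota>'] by simp
next
  case (Le s t)
  then show ?case using eval_cong[of s \<rho> \<rho>' \<kappa> \<iota> \<iota>'] eval_cong[of t \<rho> \<rho>' \<kappa> \<iota> \<iota>'] by simp
next
  case (Lt s t)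
  then show ?case using eval_cong[of s \<rho> \<rho>' \<kappa> \<iota> \<iota>'] eval_cong[of t \<rho> \<rho>' \<kappa> \<iota> \<iota>'] by simp
next
  case (And \<phi> \<psi>)
  then have "holds \<kappa> \<iota> \<rho> \<phi> \<longleftrightarrow> holds \<kappa> \<iota>' \<rho>' \<phi>" "holds \<kappa> \<iota> \<rho> \<psi> \<longleftrightarrow> holds \<kappa> \<iota>' \<rho>' \<psi>"
    by simp_all
  then show ?case by simp
next
  case (Or \<phi> \<psi>)
  then have "holds \<kappa> \<iota> \<rho> \<phi> \<longleftrightarrow> holds \<kappa> \<iota>' \<rho>' \<phi>" "holds \<kappa> \<iota> \<rho> \<psi> \<longleftrightarrow> holds \<kappa> \<iota>' \<rho>' \<psi>"
    by simp_all
  then show ?case by simp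
next
  case (Forall y \<phi>)
  then have "holds \<kappa> \<iota> (\<rho>(y := z)) \<phi> \<longleftrightarrow> holds \<kappa> \<iota>' (\<rho>'(y := z)) \<phi>" for z
    using Forall.prems by (intro Forall.IH) auto
  then show ?case by simp
next
  case (Exists y \<phi>)
  then have "holds \<kappa> \<iota> (\<rho>(y := z)) \<phi> \<longleftrightarrow> holds \<kappa> \<iota>' (\<rho>'(y := z)) \<phi>" for z
    using Exists.prems by (intro Exists.IH) auto
  then show ?case by simp
qed simp_all

lemma satisfiable_at_closed_iff_holds:
  assumes "fm_apps \<phi> = []" "free_vars \<phi> = {}"
  shows "satisfiable_at \<kappa> \<phi> \<longleftrightarrow> holds \<kappa> \<iota> \<rho> \<phi>"
proof -
  have "holds \<kappa> \<iota>' \<rho>' \<phi> \<longleftrightarrow> holds \<kappa> \<iota> \<rho> \<phi>" for \<iota>' \<rho>'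
    using assms by (intro holds_cong) auto
  then show ?thesis
    unfolding satisfiable_at_def by blast
qed

text \<open>Application-freeness is essential: \<open>x_coeff\<close> counts an application as 0,
  although its value may vary with \<open>X\<close>.\<close>

lemma eval_x_linear:
  "tm_apps t = [] \<Longrightarrow> eval \<kappa> \<iota> (\<rho>(X := z)) t = eval \<kappa> \<iota> (\<rho>(X := 0)) t + x_coeff t * z"
  by (induct t rule: tm_induct) (auto simp: algebra_simps)

section \<open>The pivot formulas are closed and free of applications\<close>

lemma fm_apps_AND: "fm_apps (AND \<phi>s) = concat (map fm_apps \<phi>s)"
  unfolding AND_def by (induction \<phi>s) auto

lemma free_vars_AND: "free_vars (AND \<phi>s) = (\<Union>\<phi> \<in> set \<phi>s. free_vars \<phi>)"
  unfolding AND_def by (induction \<phi>s) auto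

lemma tm_apps_inst_tm: "tm_apps t = [] \<Longrightarrow> tm_apps (inst_tm z t) = []"
  by (induct t rule: tm_induct) auto

lemma fm_apps_inst: "fm_apps \<phi> = [] \<Longrightarrow> fm_apps (inst z \<phi>) = []"
  by (induction \<phi>) (auto simp: tm_apps_inst_tm)

lemma tm_vars_inst_tm: "tm_vars (inst_tm z t) = tm_vars t - {X}"
  by (induct t rule: tm_induct) auto

lemma free_vars_inst: "free_vars (inst z \<phi>) = free_vars \<phi> - {X}"
  by (induction \<phi>) (auto simp: tm_vars_inst_tm)

lemma tm_vars_tm_apps: "(f, t) \<in> set (tm_apps s) \<Longrightarrow> tm_vars t \<subseteq> tm_vars s"
  by (induct s rule: tm_induct) auto

lemma tm_vars_apps:
  "quantifier_free \<phi> \<Longrightarrow> (f, t) \<in> set (apps \<phi>) \<Longrightarrow> tm_vars t \<subseteq> free_vars \<phi>"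
  unfolding apps_def by (induction \<phi>) (auto dest!: tm_vars_tm_apps)

lemma fm_apps_less_sign: "fm_apps (less_sign s t t') = [] \<longleftrightarrow> tm_apps t = [] \<and> tm_apps t' = []"
  by (auto simp: less_sign_def)

lemma free_vars_less_sign: "free_vars (less_sign s t t') = tm_vars t \<union> tm_vars t'"
  by (auto simp: less_sign_def)

text \<open>The formula compares the arguments \<open>t\<close>, not the values \<open>f(t)\<close>,
  and arguments contain no nested applications.\<close>

lemma fm_apps_ext_fm:
  assumes "\<forall>(f, t) \<in> set (apps Q). tm_apps t = []"
  shows "fm_apps (ext_fm s Q S) = []"
  unfolding ext_fm_def using assms
  by (intro fm_apps_inst) (auto simp: fm_apps_AND fm_apps_less_sign split: if_splits)

lemma free_vars_ext_fm:
  assumes "\<And>f t. (f, t) \<in> set (apps Q) \<Longrightarrow> tm_vars t \<subseteq> {X}"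
  shows "free_vars (ext_fm s Q S) = {}"
  unfolding ext_fm_def
  by (auto simp: free_vars_inst free_vars_AND free_vars_less_sign split: if_splits dest!: assms)

lemma tm_apps_abstract_tm: "tm_apps (abstract_tm S t) = []"
  by (induct t rule: tm_induct) auto

lemma fm_apps_abstract: "fm_apps (abstract S \<phi>) = []"
  by (induction \<phi>) (auto simp: tm_apps_abstract_tm)

lemma tm_vars_abstract_tm:
  "tm_vars (abstract_tm S t) \<subseteq> tm_vars t \<union> (\<lambda>(f, t). if (f, t) \<in> S then V f t else U f t) ` set (tm_apps t)"
  by (induct t rule: tm_induct) auto

text \<open>Only an inclusion: variables inside the argument of a replaced application can
  disappear.\<close>

lemma free_vars_abstract:
  "free_vars (abstract S \<phi>) \<subseteq>
    free_vars \<phi> \<union> (\<lambda>(f, t). if (f, t) \<in> S then V f t else U f t) ` set (fm_apps \<phi>)"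
proof (induction \<phi>)
  case (Eq s t)
  show ?case
    unfolding abstract.simps free_vars.simps fm_apps.simps set_append image_Un
    using tm_vars_abstract_tm[of S s] tm_vars_abstract_tm[of S t] by blast
next
  case (Le s t)
  show ?case
    unfolding abstract.simps free_vars.simps fm_apps.simps set_append image_Un
    using tm_vars_abstract_tm[of S s] tm_vars_abstract_tm[of S t] by blast
next
  case (Lt s t)
  show ?case
    unfolding abstract.simps free_vars.simps fm_apps.simps set_append image_Un
    using tm_vars_abstract_tm[of S s] tm_vars_abstract_tm[of S t] by blast
next
  case (And \<phi> \<psi>)
  then show ?case
    unfolding abstract.simps free_vars.simps fm_apps.simps set_append image_Un by blast
next
  case (Or \<phi> \<psi>)
  then show ?case
    unfolding abstract.simps free_vars.simps fm_apps.simps set_append image_Un by blast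
qed auto

lemma fm_apps_foldr_Forall: "fm_apps (foldr (\<lambda>(f, t). Forall (U f t)) as \<phi>) = fm_apps \<phi>"
  by (induct as) (simp_all split: prod.split)

lemma fm_apps_foldr_Exists: "fm_apps (foldr (\<lambda>(f, t). Exists (V f t)) as \<phi>) = fm_apps \<phi>"
  by (induct as) (simp_all split: prod.split)

lemma free_vars_foldr_Forall:
  "free_vars (foldr (\<lambda>(f, t). Forall (U f t)) as \<phi>) = free_vars \<phi> - (\<lambda>(f, t). U f t) ` set as"
  by (induct as) (auto split: prod.split)

lemma free_vars_foldr_Exists:
  "free_vars (foldr (\<lambda>(f, t). Exists (V f t)) as \<phi>) = free_vars \<phi> - (\<lambda>(f, t). V f t) ` set as"
  by (induct as) (auto split: prod.split)

lemma fm_apps_prop_fm: "fm_apps (prop_fm Q S) = []"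
  by (simp add: prop_fm_def fm_apps_foldr_Forall fm_apps_foldr_Exists fm_apps_abstract)

text \<open>The prefix binds exactly what abstraction leaves free: \<open>V f t\<close> for
  applications in \<open>S\<close>, \<open>U f t\<close> for the others, and \<open>X\<close>
  outermost.\<close>

lemma free_vars_prop_fm:
  assumes "free_vars Q \<subseteq> {X}"
  shows "free_vars (prop_fm Q S) = {}"
proof -
  have "y \<notin> free_vars (prop_fm Q S)" for y
  proof
    assume "y \<in> free_vars (prop_fm Q S)"
    then have y: "y \<in> free_vars (abstract S Q)" "y \<noteq> X"
        "y \<notin> (\<lambda>(f, t). V f t) ` (set (apps Q) \<inter> S)" "y \<notin> (\<lambda>(f, t). U f t) ` (set (apps Q) - S)"
      by (auto simp: prop_fm_def free_vars_foldr_Forall free_vars_foldr_Exists)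
    then obtain f t where "(f, t) \<in> set (apps Q)" "y = (if (f, t) \<in> S then V f t else U f t)"
      using free_vars_abstract[of S Q] assms by (auto simp: apps_def)
    with y(3,4) show False
      by (cases "(f, t) \<in> S") force+
  qed
  then show ?thesis by blast
qed

section \<open>Large intervals\<close>

text \<open>The choice made by \<open>SOME\<close> is immaterial, since in the fragment all
  arguments of \<open>f\<close> in \<open>Q\<close> share one coefficient of
  \<open>X\<close>.\<close>

lemma arg_sign_eq:
  assumes "in_fragment F Q" "(f, t) \<in> set (apps Q)"
  shows "arg_sign Q f = sgn (x_coeff t)"
proof -
  have "(f, SOME t. (f, t) \<in> set (apps Q)) \<in> set (apps Q)"
    using assms(2) by (rule someI)
  then show ?thesis
    using assms unfolding arg_sign_def in_fragment_def by metis
qed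

lemma eventually_less_linear:
  fixes a b c :: int
  assumes "c > 0"
  shows "eventually (\<lambda>n. a < b + c * int n) sequentially"
proof (rule eventually_sequentiallyI)
  \<comment> \<open>Beyond this threshold \<open>a - b < n\<close>, and \<open>n \<le> c * n\<close>
    because a positive integer slope is at least 1.\<close>
  fix n assume "nat (a - b) + 1 \<le> n"
  moreover have "1 * int n \<le> c * int n"
    using assms by (intro mult_right_mono) auto
  ultimately show "a < b + c * int n"
    by linarith
qed

text \<open>The endpoint for sign \<open>s\<close> is \<open>s * n\<close>, so the instantiated term
  is affine in \<open>n\<close> with slope \<open>x_coeff t * s\<close>. The comparison points in
  the direction of the sign of that slope, so the term eventually passes the fixed value of
  \<open>a\<close> in all four sign combinations.\<close>

lemma eventually_holds_less_sign:
  fixes a t :: "('f, 'c) tm"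
  assumes "x_coeff t \<noteq> 0" "tm_apps t = []" "s = 1 \<or> s = -1"
  shows "eventually (\<lambda>n. holds \<kappa> \<iota> \<rho>
    (less_sign (sgn (x_coeff t) * s) a (inst_tm (endpoint s (- int n, int n)) t))) sequentially"
proof -
  define k where "k = x_coeff t * s"
  define e where "e = eval \<kappa> \<iota> (\<rho>(X := 0)) t"
  have ev: "eval \<kappa> \<iota> \<rho> (inst_tm (endpoint s (- int n, int n)) t) = e + k * int n" for n
    using assms(3) eval_x_linear[OF assms(2), of \<kappa> \<iota> \<rho> "endpoint s (- int n, int n)"]
    by (auto simp: eval_inst_tm endpoint_def k_def e_def)
  have k: "sgn (x_coeff t) * s = sgn k" "k \<noteq> 0"
    using assms by (auto simp: k_def sgn_mult)
  show ?thesis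
  proof (cases "k > 0")
    case True
    then show ?thesis
      using eventually_less_linear[of k "eval \<kappa> \<iota> \<rho> a" e] by (simp add: k less_sign_def ev)
  next
    case False
    \<comment> \<open>Negating both sides reduces a negative slope to the positive case.\<close>
    then have "eventually (\<lambda>n. - eval \<kappa> \<iota> \<rho> a < - e + (- k) * int n) sequentially"
      using k(2) by (intro eventually_less_linear) simp
    then show ?thesis
      by (rule eventually_mono) (use False in \<open>simp add: k less_sign_def ev\<close>)
  qed
qed

lemma eventually_holds_psi_fm:
  fixes F Q :: "('f, 'c) fm"
  assumes frag: "in_fragment F Q" and s: "s = 1 \<or> s = -1"
    and ext: "satisfiable_at \<kappa> (ext_fm s Q S)" and prp: "satisfiable_at \<kappa> (prop_fm Q S)"
  shows "eventually (\<lambda>n. holds \<kappa> \<iota> \<rho> (psi_fm s F Q (- int n, int n) S)) sequentially"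
proof -
  have apps: "\<forall>(f, t) \<in> set (apps Q). tm_apps t = []"
    and vars: "free_vars Q \<subseteq> {X}" "quantifier_free Q"
    and coeff: "\<forall>(f, t) \<in> set (apps Q). x_coeff t \<noteq> 0"
    using frag unfolding in_fragment_def ball_Un by blast+
  have "free_vars (ext_fm s Q S) = {}"
    using tm_vars_apps[OF vars(2)] vars(1) by (intro free_vars_ext_fm) blast
  then have 1: "holds \<kappa> \<iota> \<rho> (ext_fm s Q S)"
    using ext satisfiable_at_closed_iff_holds[OF fm_apps_ext_fm[OF apps]] by blast
  have 2: "holds \<kappa> \<iota> \<rho> (prop_fm Q S)"
    using prp satisfiable_at_closed_iff_holds[OF fm_apps_prop_fm free_vars_prop_fm[OF vars(1)]]
    by blast
  \<comment> \<open>Finitely many comparisons, each true for all large \<open>n\<close>, hold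
    simultaneously for all large \<open>n\<close>.\<close>
  have "eventually (\<lambda>n. \<forall>(f, t) \<in> set (apps Q). \<forall>a \<in> set (args F f). holds \<kappa> \<iota> \<rho>
      (less_sign (arg_sign Q f * s) a (inst_tm (endpoint s (- int n, int n)) t))) sequentially"
  proof (intro eventually_ball_finite ballI finite_set, clarify)
    fix f t
    assume ft: "(f, t) \<in> set (apps Q)"
    have "x_coeff t \<noteq> 0" "tm_apps t = []"
      using ft apps coeff by auto
    then show "eventually (\<lambda>n. \<forall>a \<in> set (args F f). holds \<kappa> \<iota> \<rho>
      (less_sign (arg_sign Q f * s) a (inst_tm (endpoint s (- int n, int n)) t))) sequentially"
      unfolding arg_sign_eq[OF frag ft]
      by (intro eventually_ball_finite ballI finite_set eventually_holds_less_sign s)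
  qed
  then show ?thesis
    by (rule eventually_mono) (fastforce simp: psi_fm_def 1 2)
qed

text \<open>Here \<open>m\<close> bounds the number of enlargements still needed. The ground check
  never ends the loop, and if the full check succeeds before the \<open>m\<close>-th enlargement,
  the verdict is \<open>Sat\<close> all the same.\<close>

lemma interval_check_terminates:
  assumes ground: "\<And>B. satisfiable (ground_fm F Q B)"
    and check: "satisfiable (check_fm F Q (fst B - int m, snd B + int m))"
  shows "while_option is_running (step F Q) (Running B) = Some (Returned Sat)"
  using check
proof (induction m arbitrary: B)
  case 0
  then show ?case
    by (simp add: while_option_unfold[of is_running _ "Running B"]
        while_option_unfold[of is_running _ "Returned Sat"] ground)
next
  case (Suc m)
  \<comment> \<open>One enlargement brings the target interval one step closer, so \<open>B\<close>
    has to vary in the induction.\<close>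
  have "while_option is_running (step F Q) (Running (fst B - 1, snd B + 1)) = Some (Returned Sat)"
    using Suc.prems by (intro Suc.IH) (simp add: algebra_simps)
  then show ?case
    by (simp add: while_option_unfold[of is_running _ "Running B"]
        while_option_unfold[of is_running _ "Returned Sat"] ground)
qed

text \<open>A single \<open>\<kappa>\<close> interprets the constants in the input and in the pivot
  condition; \<open>unrelated_constants_counterexample\<close> shows that the conclusion can fail
  otherwise.\<close>

theorem theorem3:
  fixes F Q :: "('f, 'c) fm" and \<kappa> :: "'c \<Rightarrow> int"
  assumes "in_fragment F Q"
    and "satisfiable_at \<kappa> (And F (Forall X Q))"
    and "req_pivot_at \<kappa> Q"
  shows "interval_check F Q = Some (Returned Sat)"
proof -
  obtain \<iota> \<rho> where "holds \<kappa> \<iota> \<rho> (And F (Forall X Q))"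
    using assms(2) unfolding satisfiable_at_def by blast
  then have ground: "holds \<kappa> \<iota> \<rho> (ground_fm F Q B)" for B
    by (auto simp: ground_fm_def holds_inst)
  obtain S S' where S: "S \<subseteq> set (apps Q)" "S' \<subseteq> set (apps Q)"
    and sat: "satisfiable_at \<kappa> (ext_fm 1 Q S)" "satisfiable_at \<kappa> (prop_fm Q S)"
      "satisfiable_at \<kappa> (ext_fm (-1) Q S')" "satisfiable_at \<kappa> (prop_fm Q S')"
    using assms(3) unfolding req_pivot_at_def by blast
  \<comment> \<open>Both directions are satisfied by the model of the input itself, so one
    \<open>n\<close> serves both and no models have to be merged.\<close>
  have "eventually (\<lambda>n. holds \<kappa> \<iota> \<rho> (psi_fm 1 F Q (- int n, int n) S) \<and>
      holds \<kappa> \<iota> \<rho> (psi_fm (-1) F Q (- int n, int n) S')) sequentially"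
    using assms(1) sat by (intro eventually_conj eventually_holds_psi_fm) auto
  then obtain n where n: "holds \<kappa> \<iota> \<rho> (psi_fm 1 F Q (- int n, int n) S)"
      "holds \<kappa> \<iota> \<rho> (psi_fm (-1) F Q (- int n, int n) S')"
    unfolding eventually_sequentially by blast
  \<comment> \<open>The disjunctions of \<open>check_fm\<close> enumerate all subsets of the
    applications as sets of subsequences.\<close>
  have "S \<in> set (map set (subseqs (apps Q)))" "S' \<in> set (map set (subseqs (apps Q)))"
    using S by (simp_all only: set_map subseqs_powset Pow_iff)
  with n have "holds \<kappa> \<iota> \<rho> (check_fm F Q (- int n, int n))"
    by (auto simp: check_fm_def ground)
  \<comment> \<open>The loop starts at \<open>(0, 0)\<close>, so this interval is reached after at
    most \<open>n\<close> enlargements.\<close>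
  then have "satisfiable (check_fm F Q (fst (0, 0) - int n, snd (0, 0) + int n))"
    unfolding satisfiable_def satisfiable_at_def by auto
  moreover have "satisfiable (ground_fm F Q B)" for B
    using ground unfolding satisfiable_def satisfiable_at_def by blast
  ultimately show ?thesis
    unfolding interval_check_def by (intro interval_check_terminates)
qed

end
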